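(* Let $(\tilde{X}, \tilde{\rho})$ and $(X, \rho)$ be compact geodesic spaces, let $T>0$, and let $\alpha\in (0,1)$. Let $\varepsilon \in (0,\alpha^2)$ be such that $d_{\mathrm{GH}}(\tilde{X}, X)\leq\varepsilon$. If there are $(\tilde{X}, \tilde{\rho}, \alpha, T)$-winning strategies, then there are $(X, \rho, \alpha + (20T +8)\sqrt{\varepsilon}, T)$-winning strategies.
   Context: A metric space $(X,\rho)$ is a geodesic space if every two points $x,y\in X$ are joined by a geodesic path, i.e. a map $g\colon[0,l]\to X$ with $g(0)=x$, $g(l)=y$ and $\rho(g(t),g(t'))=|t-t'|$ for all $t,t'\in[0,l]$. $d_{\mathrm{GH}}$ denotes the Gromov--Hausdorff distance: $d_{\mathrm{GH}}(X,Y)$ is the infimum of $r>0$ for which there exist a metric space $Z$ and subspaces $X',Y'\subset Z$ isometric to $X$ and $Y$ respectively with $d_{\mathrm{H}}(X',Y')<r$, where $d_{\mathrm{H}}$ is the Hausdorff distance between subsets of $Z$. For a metric space $(X,\rho)$, let $\mathrm{Lip}_1(X)$ be the set of all 1-Lipschitz curves from $\mathbb{R}_+=[0,+\infty)$ to $X$ (the admissible trajectories of each player, Lion and Man). For $L_0\in X$, a map $\mathfrak{s}_{L_0}\colon \mathrm{Lip}_1(X)\to \mathrm{Lip}_1(X)$ is called a (Lion's) non-anticipative strategy with initial position $L_0$ if $\mathfrak{s}_{L_0}(M)(0)=L_0$ for all $M\in \mathrm{Lip}_1(X)$, and for all $M_1,M_2\in \mathrm{Lip}_1(X)$ and $\tau\ge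 0$: if $M_1(t)=M_2(t)$ for all $t\in[0,\tau]$, then $\mathfrak{s}_{L_0}(M_1)(t)=\mathfrak{s}_{L_0}(M_2)(t)$ for all $t\in[0,\tau]$. For a compact metric space $(X,\rho)$ and a number $\alpha>0$, "there are $(X,\rho,\alpha,T)$-winning strategies" means: for every $L_0\in X$ there is a non-anticipative strategy $\mathfrak{s}_{L_0}\colon \mathrm{Lip}_1(X)\to \mathrm{Lip}_1(X)$ with initial position $L_0$ such that $\inf_{t\in[0,T]}\rho\bigl(M(t),\mathfrak{s}_{L_0}(M)(t)\bigr)\le\alpha$ for all $M\in \mathrm{Lip}_1(X)$. *)

theory Defs
  imports "HOL-Analysis.Analysis"
begin

definition geodesic_space :: "'a metric \<Rightarrow> bool" where
  "geodesic_space X \<longleftrightarrow>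
    (\<forall>x\<in>mspace X. \<forall>y\<in>mspace X. \<exists>(l::real)\<ge>0. \<exists>g. g \<in> {0..l} \<rightarrow> mspace X \<and> g 0 = x \<and> g l = y \<and>
      (\<forall>t\<in>{0..l}. \<forall>t'\<in>{0..l}. mdist X (g t) (g t') = \<bar>t - t'\<bar>))"

(* With extended values the Hausdorff distance between an empty and a nonempty
   set is \<infinity>, and the infimum defining the Gromov-Hausdorff distance is \<infinity>
   when no r is admissible. *)
definition hausdorff_dist :: "'a metric \<Rightarrow> 'a set \<Rightarrow> 'a set \<Rightarrow> ennreal" where
  "hausdorff_dist Z A B =
    max (SUP a\<in>A. INF b\<in>B. ennreal (mdist Z a b)) (SUP b\<in>B. INF a\<in>A. ennreal (mdist Z a b))"

definition isometric :: "'a metric \<Rightarrow> 'b metric \<Rightarrow> bool" where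
  "isometric X Y \<longleftrightarrow>
    (\<exists>f. bij_betw f (mspace X) (mspace Y) \<and>
      (\<forall>x\<in>mspace X. \<forall>x'\<in>mspace X. mdist Y (f x) (f x') = mdist X x x'))"

definition gh_admissible :: "'c metric \<Rightarrow> 'a metric \<Rightarrow> 'b metric \<Rightarrow> real \<Rightarrow> bool" where
  "gh_admissible Z X Y r \<longleftrightarrow>
    (\<exists>X' Y'. X' \<subseteq> mspace Z \<and> Y' \<subseteq> mspace Z \<and>
      isometric (submetric Z X') X \<and> isometric (submetric Z Y') Y \<and>
      hausdorff_dist Z X' Y' < ennreal r)"

(* HOL cannot quantify over the type of points of the ambient space Z.  It is
   enough to let Z range over the metric spaces with points in 'a + 'b, because
   only X' \<union> Y' matters and it injects into 'a + 'b; the two lemmas below show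
   that an ambient space over any other type contributes nothing new. *)
definition gh_dist :: "'a metric \<Rightarrow> 'b metric \<Rightarrow> ennreal" where
  "gh_dist X Y = Inf {ennreal r | r. r > 0 \<and> (\<exists>Z :: ('a + 'b) metric. gh_admissible Z X Y r)}"

lemma gh_admissible_transfer:
  fixes Z :: "'c metric" and X :: "'a metric" and Y :: "'b metric"
  assumes "gh_admissible Z X Y r"
  shows "\<exists>W :: ('a + 'b) metric. gh_admissible W X Y r"
proof -
  obtain X' Y' f g where sub: "X' \<subseteq> mspace Z" "Y' \<subseteq> mspace Z"
    and f: "bij_betw f X' (mspace X)" "\<And>x x'. x \<in> X' \<Longrightarrow> x' \<in> X' \<Longrightarrow> mdist X (f x) (f x') = mdist Z x x'"
    and g: "bij_betw g Y' (mspace Y)" "\<And>x x'. x \<in> Y' \<Longrightarrow> x' \<in> Y' \<Longrightarrow> mdist Y (g x) (g x') = mdist Z x x'"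
    and hd: "hausdorff_dist Z X' Y' < ennreal r"
    using assms unfolding gh_admissible_def isometric_def
    by (auto simp: Int_absorb2)
  define U where "U = X' \<union> Y'"
  define h :: "'c \<Rightarrow> 'a + 'b" where "h z = (if z \<in> X' then Inl (f z) else Inr (g z))" for z
  have inj: "inj_on h U"
    using f(1) g(1) by (auto simp: inj_on_def h_def U_def bij_betw_def)
  define k where "k = inv_into U h"
  have kh: "k (h z) = z" if "z \<in> U" for z
    using inj that by (simp add: k_def)
  have UZ: "U \<subseteq> mspace Z" using sub by (simp add: U_def)
  have M: "Metric_space (h ` U) (\<lambda>p q. mdist Z (k p) (k q))"
  proof
    show "0 \<le> mdist Z (k p) (k q)" "mdist Z (k p) (k q) = mdist Z (k q) (k p)" for p q
      by (simp_all add: mdist_commute)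
    show "(mdist Z (k p) (k q) = 0) = (p = q)" if "p \<in> h ` U" "q \<in> h ` U" for p q
      using that UZ by (auto simp: kh subset_iff)
    show "mdist Z (k p) (k s) \<le> mdist Z (k p) (k q) + mdist Z (k q) (k s)"
      if "p \<in> h ` U" "q \<in> h ` U" "s \<in> h ` U" for p q s
      using that UZ by (auto simp: kh subset_iff intro!: mdist_triangle)
  qed
  define W where "W = metric (h ` U, \<lambda>p q. mdist Z (k p) (k q))"
  have W: "mspace W = h ` U" "mdist W = (\<lambda>p q. mdist Z (k p) (k q))"
    using M by (simp_all add: W_def Metric_space.mspace_metric Metric_space.mdist_metric)
  have iso: "isometric (submetric W (h ` A)) V"
    if A: "A \<subseteq> U" and b: "bij_betw e A (mspace V)"
      and d: "\<And>x x'. x \<in> A \<Longrightarrow> x' \<in> A \<Longrightarrow> mdist V (e x) (e x') = mdist Z x x'"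
    for A and V :: "'d metric" and e
  proof -
    have sp: "mspace (submetric W (h ` A)) = h ` A"
      using A by (auto simp: W)
    have "bij_betw k (h ` A) A"
      by (rule bij_betw_byWitness[where f' = h]) (use A kh in auto)
    then have "bij_betw (e \<circ> k) (h ` A) (mspace V)"
      using b by (rule bij_betw_trans)
    moreover have "mdist V (e (k p)) (e (k q)) = mdist Z (k p) (k q)" if "p \<in> h ` A" "q \<in> h ` A" for p q
      using that A d by (auto simp: kh subset_iff)
    ultimately show ?thesis
      unfolding isometric_def sp mdist_submetric W(2) by (intro exI[of _ "e \<circ> k"]) auto
  qed
  have "hausdorff_dist W (h ` X') (h ` Y') = hausdorff_dist Z X' Y'"
    unfolding hausdorff_dist_def W(2) image_image
    by (intro arg_cong2[where f = max] SUP_cong INF_cong refl) (simp_all add: kh U_def)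
  moreover have "isometric (submetric W (h ` X')) X" "isometric (submetric W (h ` Y')) Y"
    using iso[OF _ f] iso[OF _ g] by (auto simp: U_def)
  ultimately have "gh_admissible W X Y r"
    using hd unfolding gh_admissible_def
    by (intro exI[of _ "h ` X'"] exI[of _ "h ` Y'"]) (auto simp: W U_def)
  then show ?thesis ..
qed

lemma gh_dist_le:
  assumes "gh_admissible Z X Y r" "r > 0"
  shows "gh_dist X Y \<le> ennreal r"
  using gh_admissible_transfer[OF assms(1)] assms(2)
  unfolding gh_dist_def by (intro Inf_lower) auto

(* PiE makes the curves extensional functions on [0,\<infinity>), so that equality of
   curves is equality on [0,\<infinity>). *)
definition Lip1 :: "'a metric \<Rightarrow> (real \<Rightarrow> 'a) set" where
  "Lip1 X = {f \<in> {0..} \<rightarrow>\<^sub>E mspace X. \<forall>s\<ge>0. \<forall>t\<ge>0. mdist X (f s) (f t) \<le> \<bar>s - t\<bar>}"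

definition nonanticipative_strategy ::
  "'a metric \<Rightarrow> 'a \<Rightarrow> ((real \<Rightarrow> 'a) \<Rightarrow> (real \<Rightarrow> 'a)) \<Rightarrow> bool" where
  "nonanticipative_strategy X L0 \<sigma> \<longleftrightarrow>
    \<sigma> \<in> Lip1 X \<rightarrow> Lip1 X \<and>
    (\<forall>M\<in>Lip1 X. \<sigma> M 0 = L0) \<and>
    (\<forall>M1\<in>Lip1 X. \<forall>M2\<in>Lip1 X. \<forall>\<tau>\<ge>0.
      (\<forall>t\<in>{0..\<tau>}. M1 t = M2 t) \<longrightarrow> (\<forall>t\<in>{0..\<tau>}. \<sigma> M1 t = \<sigma> M2 t))"

definition winning_strategies :: "'a metric \<Rightarrow> real \<Rightarrow> real \<Rightarrow> bool" where
  "winning_strategies X \<alpha> T \<longleftrightarrow>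
    (\<forall>L0\<in>mspace X. \<exists>\<sigma>. nonanticipative_strategy X L0 \<sigma> \<and>
      (\<forall>M\<in>Lip1 X. (INF t\<in>{0..T}. mdist X (M t) (\<sigma> M t)) \<le> \<alpha>))"

end

theory Submission
  imports Defs
begin

text \<open>The Gromov--Hausdorff hypothesis provides a correspondence between the two spaces that
  changes distances by at most some \<open>\<eta>\<close> slightly larger than \<open>2 * \<epsilon>\<close>
  (\<open>gh_dist_less_imp_correspondence\<close>). It maps points to points but is not continuous, so it cannot
  transport Lipschitz curves. Curves are transported by sampling instead: take their positions at
  the multiples of a step, move these to the other space, and join consecutive points by geodesics.
  Points at distance at most \<open>\<delta>\<close> are moved to points at distance at most \<open>\<delta> + \<eta>\<close>, so the polygonal
  curve is 1-Lipschitz provided each edge is given time \<open>\<delta> + \<eta>\<close>: each passage to the other space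
  slows the clock by the factor \<open>1 + \<eta> / \<delta>\<close>.

  Lion in \<open>X\<close> samples Man with step \<open>\<delta>\<close> and builds an image of Man in \<open>X'\<close> with step \<open>\<delta> + \<eta>\<close>,
  lets the given strategy answer there, and follows the polygonal image in \<open>X\<close> of that answer with
  step \<open>\<delta> + 2 * \<eta>\<close>. An edge cannot be entered before its far endpoint is known, so the image of Man
  waits for one step at the start. This is what makes the new strategy non-anticipative
  (\<open>winning_strategies_transfer\<close>). When the auxiliary Lion is within \<open>\<alpha>\<close> of the auxiliary Man, the
  real distance is larger by a bounded number of steps and distortions, plus the clock lag: it
  amounts to at most \<open>\<eta>\<close> for each of the at most \<open>T / \<delta>\<close> steps, up to a constant factor. The sum
  \<open>3 * \<delta> + 3 * \<eta> + 3 * \<eta> * T / \<delta>\<close> of these errors has order \<open>sqrt \<epsilon>\<close> when \<open>\<delta>\<close> is a multiple of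
  \<open>sqrt \<epsilon>\<close>.\<close>

section \<open>Correspondences of small distortion\<close>

lemma mdist_self: "x \<in> mspace X \<Longrightarrow> mdist X x x = 0"
  by (simp only: mdist_zero)

lemma hausdorff_dist_lessD:
  assumes "hausdorff_dist Z A B < ennreal r"
  shows "a \<in> A \<Longrightarrow> \<exists>b\<in>B. mdist Z a b < r" and "b \<in> B \<Longrightarrow> \<exists>a\<in>A. mdist Z a b < r"
proof -
  have 1: "(SUP a\<in>A. INF b\<in>B. ennreal (mdist Z a b)) < ennreal r"
    and 2: "(SUP b\<in>B. INF a\<in>A. ennreal (mdist Z a b)) < ennreal r"
    using assms by (simp_all add: hausdorff_dist_def)
  show "\<exists>b\<in>B. mdist Z a b < r" if "a \<in> A"
  proof -
    have "(INF b\<in>B. ennreal (mdist Z a b)) < ennreal r"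
      using 1 that by (meson SUP_upper le_less_trans)
    then show ?thesis by (auto simp: INF_less_iff ennreal_less_iff)
  qed
  show "\<exists>a\<in>A. mdist Z a b < r" if "b \<in> B"
  proof -
    have "(INF a\<in>A. ennreal (mdist Z a b)) < ennreal r"
      using 2 that by (meson SUP_upper le_less_trans)
    then show ?thesis by (auto simp: INF_less_iff ennreal_less_iff)
  qed
qed

definition correspondence :: "'a metric \<Rightarrow> 'b metric \<Rightarrow> real \<Rightarrow> ('a \<Rightarrow> 'b \<Rightarrow> bool) \<Rightarrow> bool" where
  "correspondence X Y \<eta> R \<longleftrightarrow>
    (\<forall>x\<in>mspace X. \<exists>y\<in>mspace Y. R x y) \<and> (\<forall>y\<in>mspace Y. \<exists>x\<in>mspace X. R x y) \<and>
    (\<forall>x\<in>mspace X. \<forall>x'\<in>mspace X. \<forall>y\<in>mspace Y. \<forall>y'\<in>mspace Y.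
      R x y \<longrightarrow> R x' y' \<longrightarrow> \<bar>mdist X x x' - mdist Y y y'\<bar> \<le> \<eta>)"

text \<open>Two points are made to correspond when their copies in a common ambient space are closer
  than \<open>r\<close>; by the triangle inequality through the two pairs, distances then change by less
  than \<open>2 * r\<close>.\<close>

lemma gh_dist_less_imp_correspondence:
  fixes X :: "'a metric" and Y :: "'b metric"
  assumes "gh_dist X Y < ennreal r"
  shows "\<exists>R. correspondence X Y (2 * r) R"
proof -
  obtain q and Z :: "('a + 'b) metric" where "q > 0" "ennreal q < ennreal r" "gh_admissible Z X Y q"
    using assms unfolding gh_dist_def Inf_less_iff by blast
  then obtain A B f g where sub: "A \<subseteq> mspace Z" "B \<subseteq> mspace Z"
    and f: "bij_betw f A (mspace X)" "\<And>x x'. x \<in> A \<Longrightarrow> x' \<in> A \<Longrightarrow> mdist X (f x) (f x') = mdist Z x x'"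
    and g: "bij_betw g B (mspace Y)" "\<And>x x'. x \<in> B \<Longrightarrow> x' \<in> B \<Longrightarrow> mdist Y (g x) (g x') = mdist Z x x'"
    and "hausdorff_dist Z A B < ennreal q"
    unfolding gh_admissible_def isometric_def
    by (auto simp: Int_absorb2)
  then have hd: "hausdorff_dist Z A B < ennreal r"
    using \<open>ennreal q < ennreal r\<close> by (meson less_trans)
  define R where "R x y \<longleftrightarrow> (\<exists>a\<in>A. \<exists>b\<in>B. f a = x \<and> g b = y \<and> mdist Z a b < r)" for x y
  have fA: "f ` A = mspace X" and gB: "g ` B = mspace Y"
    using f(1) g(1) by (auto simp: bij_betw_def)
  have "\<exists>y\<in>mspace Y. R x y" if x: "x \<in> mspace X" for x
  proof -
    obtain a where a: "a \<in> A" "f a = x" using x unfolding fA[symmetric] by blast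
    obtain b where b: "b \<in> B" "mdist Z a b < r" using hausdorff_dist_lessD(1)[OF hd a(1)] by blast
    have "g b \<in> mspace Y" using b(1) gB by blast
    then show ?thesis using a b unfolding R_def by blast
  qed
  moreover have "\<exists>x\<in>mspace X. R x y" if y: "y \<in> mspace Y" for y
  proof -
    obtain b where b: "b \<in> B" "g b = y" using y unfolding gB[symmetric] by blast
    obtain a where a: "a \<in> A" "mdist Z a b < r" using hausdorff_dist_lessD(2)[OF hd b(1)] by blast
    have "f a \<in> mspace X" using a(1) fA by blast
    then show ?thesis using a b unfolding R_def by blast
  qed
  moreover have "\<bar>mdist X x x' - mdist Y y y'\<bar> \<le> 2 * r" if "R x y" "R x' y'" for x x' y y'
  proof -
    obtain a b where ab: "a \<in> A" "b \<in> B" "f a = x" "g b = y" "mdist Z a b < r"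
      using \<open>R x y\<close> unfolding R_def by blast
    obtain a' b' where ab': "a' \<in> A" "b' \<in> B" "f a' = x'" "g b' = y'" "mdist Z a' b' < r"
      using \<open>R x' y'\<close> unfolding R_def by blast
    have mem: "a \<in> mspace Z" "b \<in> mspace Z" "a' \<in> mspace Z" "b' \<in> mspace Z"
      using ab ab' sub by auto
    have "mdist Z a a' \<le> mdist Z a b + (mdist Z b b' + mdist Z a' b')"
      using mdist_triangle[OF mem(1,2,3)] mdist_triangle[OF mem(2,4,3)]
      by (simp add: mdist_commute[of Z b' a'])
    moreover have "mdist Z b b' \<le> mdist Z a b + (mdist Z a a' + mdist Z a' b')"
      using mdist_triangle[OF mem(2,1,4)] mdist_triangle[OF mem(1,3,4)]
      by (simp add: mdist_commute[of Z b a])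
    moreover have "mdist X x x' = mdist Z a a'" "mdist Y y y' = mdist Z b b'"
      using ab ab' f(2) g(2) by auto
    ultimately show ?thesis using ab(5) ab'(5) by linarith
  qed
  ultimately show ?thesis unfolding correspondence_def by blast
qed

section \<open>Polygonal curves with edges of equal duration\<close>

definition segment :: "'a metric \<Rightarrow> real \<Rightarrow> 'a \<Rightarrow> 'a \<Rightarrow> real \<Rightarrow> 'a" where
  "segment X h x y = (SOME c. c \<in> {0..h} \<rightarrow> mspace X \<and> c 0 = x \<and> c h = y \<and>
    (\<forall>s\<in>{0..h}. \<forall>t\<in>{0..h}. mdist X (c s) (c t) \<le> \<bar>s - t\<bar>))"

text \<open>A geodesic of length at most \<open>h\<close>, followed by a wait at its endpoint, fills the time
  \<open>h\<close> exactly.\<close>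

lemma segment:
  assumes "geodesic_space X" "x \<in> mspace X" "y \<in> mspace X" "mdist X x y \<le> h"
  shows "segment X h x y \<in> {0..h} \<rightarrow> mspace X"
    and "segment X h x y 0 = x" and "segment X h x y h = y"
    and "\<And>s t. s \<in> {0..h} \<Longrightarrow> t \<in> {0..h} \<Longrightarrow>
           mdist X (segment X h x y s) (segment X h x y t) \<le> \<bar>s - t\<bar>"
proof -
  obtain l g where l: "l \<ge> 0" and g: "g \<in> {0..l} \<rightarrow> mspace X" "g 0 = x" "g l = y"
    and iso: "\<And>t t'. t \<in> {0..l} \<Longrightarrow> t' \<in> {0..l} \<Longrightarrow> mdist X (g t) (g t') = \<bar>t - t'\<bar>"
    using assms(1-3) unfolding geodesic_space_def by metis
  have lh: "l \<le> h" using iso[of 0 l] l g assms(4) by simp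
  have "\<exists>c. c \<in> {0..h} \<rightarrow> mspace X \<and> c 0 = x \<and> c h = y \<and>
    (\<forall>s\<in>{0..h}. \<forall>t\<in>{0..h}. mdist X (c s) (c t) \<le> \<bar>s - t\<bar>)"
  proof (intro exI[of _ "\<lambda>t. g (min t l)"] conjI ballI)
    show "(\<lambda>t. g (min t l)) \<in> {0..h} \<rightarrow> mspace X" using g l by auto
    show "g (min 0 l) = x" "g (min h l) = y" using g l lh by (auto simp: min_def)
    show "mdist X (g (min s l)) (g (min t l)) \<le> \<bar>s - t\<bar>" if "s \<in> {0..h}" "t \<in> {0..h}" for s t
      using that l by (subst iso) auto
  qed
  from someI_ex[OF this] show "segment X h x y \<in> {0..h} \<rightarrow> mspace X"
    and "segment X h x y 0 = x" and "segment X h x y h = y"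
    and "\<And>s t. s \<in> {0..h} \<Longrightarrow> t \<in> {0..h} \<Longrightarrow>
           mdist X (segment X h x y s) (segment X h x y t) \<le> \<bar>s - t\<bar>"
    unfolding segment_def by blast+
qed

definition polygon :: "'a metric \<Rightarrow> real \<Rightarrow> (nat \<Rightarrow> 'a) \<Rightarrow> real \<Rightarrow> 'a" where
  "polygon X h p = (\<lambda>t\<in>{0..}. let n = nat \<lfloor>t / h\<rfloor> in segment X h (p n) (p (Suc n)) (t - real n * h))"

lemma ex_grid_interval:
  fixes h t :: real
  assumes "h > 0" "t \<ge> 0"
  obtains n where "real n * h \<le> t" "t < (real n + 1) * h" "nat \<lfloor>t / h\<rfloor> = n"
proof
  have nonneg: "0 \<le> t / h" using assms by simp
  have n: "real (nat \<lfloor>t / h\<rfloor>) = of_int \<lfloor>t / h\<rfloor>"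
    using nonneg by simp
  show "real (nat \<lfloor>t / h\<rfloor>) * h \<le> t"
    unfolding n using floor_divide_lower[OF assms(1)] by blast
  show "t < (real (nat \<lfloor>t / h\<rfloor>) + 1) * h"
    unfolding n using floor_divide_upper[OF assms(1)] by blast
qed simp

locale short_edges =
  fixes X :: "'a metric" and h :: real and p :: "nat \<Rightarrow> 'a"
  assumes geodesic: "geodesic_space X" and h_pos: "h > 0"
    and vertex: "\<And>n. p n \<in> mspace X" and edge: "\<And>n. mdist X (p n) (p (Suc n)) \<le> h"
begin

lemmas seg = segment[OF geodesic vertex vertex edge]

lemma polygon_on_edge:
  assumes "real n * h \<le> t" "t \<le> (real n + 1) * h"
  shows "polygon X h p t = segment X h (p n) (p (Suc n)) (t - real n * h)"
proof -
  have t0: "t \<ge> 0" using assms(1) h_pos by (meson mult_nonneg_nonneg of_nat_0_le_iff less_imp_le order_trans)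
  show ?thesis
  proof (cases "t = (real n + 1) * h")
    case True
    \<comment> \<open>the vertex at \<open>t\<close> is assigned to the following edge by the floor\<close>
    have "nat \<lfloor>t / h\<rfloor> = Suc n" using True h_pos by (simp add: nat_add_distrib)
    then show ?thesis
      using True t0 by (simp add: polygon_def seg algebra_simps)
  next
    case False
    then have "t < (real n + 1) * h" using assms(2) by simp
    then have "\<lfloor>t / h\<rfloor> = int n"
      using assms(1) h_pos by (intro floor_unique) (simp_all add: field_simps)
    then show ?thesis using t0 by (simp add: polygon_def)
  qed
qed

lemma polygon_vertex: "polygon X h p (real n * h) = p n"
  using polygon_on_edge[of n "real n * h"] h_pos by (simp add: seg algebra_simps)

lemma polygon_edge_Lipschitz:
  assumes "real n * h \<le> s" "s \<le> t" "t \<le> (real n + 1) * h"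
  shows "mdist X (polygon X h p s) (polygon X h p t) \<le> t - s"
proof -
  have "polygon X h p s = segment X h (p n) (p (Suc n)) (s - real n * h)"
    and "polygon X h p t = segment X h (p n) (p (Suc n)) (t - real n * h)"
    using assms by (intro polygon_on_edge; linarith)+
  moreover have "s - real n * h \<in> {0..h}" "t - real n * h \<in> {0..h}"
    using assms by (auto simp: algebra_simps)
  ultimately show ?thesis using seg(4)[of "s - real n * h" "t - real n * h" n] assms(2) by simp
qed

lemma polygon_in_space:
  assumes "t \<ge> 0" shows "polygon X h p t \<in> mspace X"
proof -
  obtain n where n: "real n * h \<le> t" "t < (real n + 1) * h"
    using ex_grid_interval[OF h_pos assms] by blast
  then have "t - real n * h \<in> {0..h}" by (simp add: algebra_simps)
  then show ?thesis using n seg(1)[of n] by (auto simp: polygon_on_edge)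
qed

lemma mdist_vertices_le: "mdist X (p m) (p (m + k)) \<le> real k * h"
proof (induction k)
  case 0
  show ?case by (simp add: vertex mdist_self)
next
  case (Suc k)
  have "mdist X (p m) (p (m + Suc k)) \<le> mdist X (p m) (p (m + k)) + mdist X (p (m + k)) (p (m + Suc k))"
    by (rule mdist_triangle) (simp_all add: vertex)
  also have "\<dots> \<le> real k * h + h" using Suc.IH edge[of "m + k"] by simp
  finally show ?case by (simp add: algebra_simps)
qed

lemma polygon_Lipschitz:
  assumes "0 \<le> s" "s \<le> t"
  shows "mdist X (polygon X h p s) (polygon X h p t) \<le> t - s"
proof -
  have "t \<ge> 0" using assms by simp
  obtain i where i: "real i * h \<le> s" "s < (real i + 1) * h"
    using ex_grid_interval[OF h_pos assms(1)] by blast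
  obtain j where j: "real j * h \<le> t" "t < (real j + 1) * h"
    using ex_grid_interval[OF h_pos \<open>t \<ge> 0\<close>] by blast
  show ?thesis
  proof (cases "t \<le> (real i + 1) * h")
    case True
    then show ?thesis using polygon_edge_Lipschitz i assms by blast
  next
    case False
    then have "(real i + 1) * h < (real j + 1) * h" using j by linarith
    then have "Suc i \<le> j" using h_pos by (simp only: mult_less_cancel_right_pos)
    then obtain k where k: "j = Suc i + k" using le_iff_add by blast
    let ?c = "polygon X h p"
    have "mdist X (?c s) (?c t) \<le> mdist X (?c s) (p (Suc i)) + mdist X (p (Suc i)) (?c t)"
      using assms \<open>t \<ge> 0\<close> by (intro mdist_triangle) (simp_all add: vertex polygon_in_space)
    moreover have "mdist X (p (Suc i)) (?c t) \<le> mdist X (p (Suc i)) (p j) + mdist X (p j) (?c t)"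
      using assms \<open>t \<ge> 0\<close> by (intro mdist_triangle) (simp_all add: vertex polygon_in_space)
    moreover have "mdist X (?c s) (p (Suc i)) \<le> (real i + 1) * h - s"
      using polygon_edge_Lipschitz[of i s "(real i + 1) * h"] polygon_vertex[of "Suc i"] i
      by (simp add: algebra_simps)
    moreover have "mdist X (p (Suc i)) (p j) \<le> real k * h"
      using mdist_vertices_le[of "Suc i" k] k by simp
    moreover have "mdist X (p j) (?c t) \<le> t - real j * h"
      using polygon_edge_Lipschitz[of j "real j * h" t] polygon_vertex[of j] j by simp
    ultimately show ?thesis unfolding k by (simp add: algebra_simps)
  qed
qed

lemma polygon_Lip1: "polygon X h p \<in> Lip1 X"
proof -
  have "mdist X (polygon X h p s) (polygon X h p t) \<le> \<bar>s - t\<bar>" if "s \<ge> 0" "t \<ge> 0" for s t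
  proof (cases "s \<le> t")
    case True
    then show ?thesis using polygon_Lipschitz[of s t] that by simp
  next
    case False
    then show ?thesis using polygon_Lipschitz[of t s] that by (simp add: mdist_commute)
  qed
  moreover have "polygon X h p \<in> extensional {0..}"
    by (simp add: polygon_def)
  ultimately show ?thesis using polygon_in_space by (auto simp: Lip1_def PiE_def)
qed

end

text \<open>Up to the time of vertex \<open>n\<close> the curve depends only on the vertices up to \<open>n\<close>. At that time
  itself the floor selects the edge from \<open>n\<close> to \<open>n + 1\<close>, but only its initial point matters.
  Non-anticipativity of the transferred strategy rests on this.\<close>

lemma polygon_cong:
  assumes "short_edges X h p" "short_edges X h q"
    and eq: "\<And>k. k \<le> n \<Longrightarrow> p k = q k" and t: "0 \<le> t" "t \<le> real n * h"
  shows "polygon X h p t = polygon X h q t"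
proof -
  interpret p: short_edges X h p by fact
  interpret q: short_edges X h q by fact
  obtain k where k: "real k * h \<le> t" "t < (real k + 1) * h"
    using ex_grid_interval[OF p.h_pos t(1)] by blast
  show ?thesis
  proof (cases "k < n")
    case True
    then show ?thesis using k eq by (simp add: p.polygon_on_edge q.polygon_on_edge)
  next
    case False
    then have "real n * h \<le> real k * h" using p.h_pos by simp
    then have t: "t = real n * h" using k t by linarith
    show ?thesis unfolding t by (simp add: p.polygon_vertex q.polygon_vertex eq)
  qed
qed

section \<open>Transferring the game\<close>

lemma Lip1D:
  assumes "f \<in> Lip1 X" "s \<ge> 0" "t \<ge> 0"
  shows "f t \<in> mspace X" "mdist X (f s) (f t) \<le> \<bar>s - t\<bar>"
  using assms by (auto simp: Lip1_def)

lemma mdist_step_le: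
  assumes "f \<in> Lip1 X" "d \<ge> 0"
  shows "mdist X (f (real n * d)) (f (real (Suc n) * d)) \<le> d"
proof -
  have "\<bar>real n * d - real (Suc n) * d\<bar> = d" using assms(2) by (simp add: algebra_simps)
  then show ?thesis
    using Lip1D(2)[OF assms(1), of "real n * d" "real (Suc n) * d"] assms(2) by simp
qed

lemma mdist_quad:
  assumes "a \<in> mspace X" "b \<in> mspace X" "c \<in> mspace X" "d \<in> mspace X"
  shows "mdist X a d \<le> mdist X a b + mdist X b c + mdist X c d"
  using mdist_triangle[OF assms(1,2,4)] mdist_triangle[OF assms(2,3,4)] by linarith

text \<open>Suppose that the auxiliary players come within about \<open>\<alpha>\<close> during step \<open>k\<close>. Going back to the
  beginning of that step costs \<open>2 * (\<delta> + \<eta>)\<close>, and returning to \<open>X\<close> costs \<open>\<eta>\<close>: position \<open>k - 1\<close> of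
  Man is then compared with vertex \<open>k\<close> of Lion's polygon. Lion reaches that vertex at time
  \<open>w = k * (\<delta> + 2 * \<eta>)\<close>, whereas Man was at that position at time \<open>(k - 1) * \<delta>\<close>; since moreover
  \<open>w\<close> can exceed \<open>T\<close> by up to \<open>k * \<eta>\<close>, the distance is evaluated at \<open>min w T\<close>. Moving the two
  players to that time costs at most \<open>\<delta> + 2 * k * \<eta>\<close> and \<open>k * \<eta>\<close>, where \<open>k \<le> T / \<delta>\<close>.\<close>

lemma winning_strategies_transfer:
  fixes X' :: "'a metric" and X :: "'b metric"
  assumes geo: "geodesic_space X'" "geodesic_space X"
    and R: "correspondence X' X \<eta> R" and "\<eta> \<ge> 0" "\<delta> > 0" "T \<ge> 0"
    and win: "winning_strategies X' \<alpha> T"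
  shows "winning_strategies X (\<alpha> + 3 * \<delta> + 3 * \<eta> + 3 * \<eta> * (T / \<delta>)) T"
  unfolding winning_strategies_def
proof
  fix L0 assume L0: "L0 \<in> mspace X"
  obtain L0' where L0': "L0' \<in> mspace X'" "R L0' L0"
    using R L0 unfolding correspondence_def by blast
  have "\<forall>x\<in>mspace X. \<exists>y. y \<in> mspace X' \<and> R y x"
    using R unfolding correspondence_def by blast
  then obtain \<phi> where \<phi>: "\<And>x. x \<in> mspace X \<Longrightarrow> \<phi> x \<in> mspace X'" "\<And>x. x \<in> mspace X \<Longrightarrow> R (\<phi> x) x"
    by metis
  \<comment> \<open>the image of Lion must start exactly at \<open>L0\<close>, not just at some point corresponding to \<open>L0'\<close>\<close>
  have "\<forall>y\<in>mspace X'. \<exists>x. x \<in> mspace X \<and> R y x \<and> (y = L0' \<longrightarrow> x = L0)"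
    using R L0 L0' unfolding correspondence_def by blast
  then obtain \<psi> where \<psi>: "\<And>y. y \<in> mspace X' \<Longrightarrow> \<psi> y \<in> mspace X" "\<And>y. y \<in> mspace X' \<Longrightarrow> R y (\<psi> y)"
    and \<psi>0: "\<psi> L0' = L0"
    using L0' by metis
  have distortion: "\<bar>mdist X' y y' - mdist X x x'\<bar> \<le> \<eta>"
    if "R y x" "R y' x'" "x \<in> mspace X" "x' \<in> mspace X" "y \<in> mspace X'" "y' \<in> mspace X'" for x x' y y'
    using R that unfolding correspondence_def by blast
  obtain \<sigma>' where \<sigma>': "nonanticipative_strategy X' L0' \<sigma>'"
    and \<sigma>'win: "\<And>M. M \<in> Lip1 X' \<Longrightarrow> (INF t\<in>{0..T}. mdist X' (M t) (\<sigma>' M t)) \<le> \<alpha>"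
    using win L0'(1) unfolding winning_strategies_def by blast
  have \<sigma>'Lip: "\<And>M. M \<in> Lip1 X' \<Longrightarrow> \<sigma>' M \<in> Lip1 X'"
    and \<sigma>'0: "\<And>M. M \<in> Lip1 X' \<Longrightarrow> \<sigma>' M 0 = L0'"
    and \<sigma>'na: "\<And>M1 M2 \<tau> t. \<lbrakk>M1 \<in> Lip1 X'; M2 \<in> Lip1 X'; \<forall>t\<in>{0..\<tau>}. M1 t = M2 t; 0 \<le> t; t \<le> \<tau>\<rbrakk>
      \<Longrightarrow> \<sigma>' M1 t = \<sigma>' M2 t"
    subgoal using \<sigma>' unfolding nonanticipative_strategy_def by blast
    subgoal using \<sigma>' unfolding nonanticipative_strategy_def by blast
    subgoal for M1 M2 \<tau> t using \<sigma>' order_trans[of 0 t \<tau>] unfolding nonanticipative_strategy_def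
      by (meson atLeastAtMost_iff)
    done
  let ?\<delta>' = "\<delta> + \<eta>" and ?\<delta>'' = "\<delta> + 2 * \<eta>"
  have pos: "?\<delta>' > 0" "?\<delta>'' > 0" using assms by auto
  \<comment> \<open>the truncated predecessor delays the image of Man by one step\<close>
  define p where "p M n = \<phi> (M (real (n - 1) * \<delta>))" for M n
  define Man where "Man M = polygon X' ?\<delta>' (p M)" for M
  define q where "q M n = \<psi> (\<sigma>' (Man M) (real n * ?\<delta>'))" for M n
  define \<sigma> where "\<sigma> M = polygon X ?\<delta>'' (q M)" for M
  have grid: "real n * \<delta> \<ge> 0" "real n * ?\<delta>' \<ge> 0" for n
    using assms pos by simp_all
  have p: "short_edges X' ?\<delta>' (p M)" if M: "M \<in> Lip1 X" for M
  proof
    show "geodesic_space X'" "?\<delta>' > 0" by fact+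
    have Mg: "M (real n * \<delta>) \<in> mspace X" for n using Lip1D(1)[OF M] grid by blast
    then show "p M n \<in> mspace X'" for n using \<phi> p_def by simp
    show "mdist X' (p M n) (p M (Suc n)) \<le> ?\<delta>'" for n
    proof (cases n)
      case 0
      have "\<phi> (M 0) \<in> mspace X'" using \<phi>(1) Mg[of 0] by simp
      then show ?thesis using pos by (simp add: 0 p_def mdist_self)
    next
      case (Suc m)
      have "mdist X (M (real m * \<delta>)) (M (real (Suc m) * \<delta>)) \<le> \<delta>"
        using mdist_step_le[OF M] assms by simp
      moreover have "\<bar>mdist X' (\<phi> (M (real m * \<delta>))) (\<phi> (M (real (Suc m) * \<delta>))) -
          mdist X (M (real m * \<delta>)) (M (real (Suc m) * \<delta>))\<bar> \<le> \<eta>"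
        by (intro distortion \<phi> Mg)
      ultimately show ?thesis unfolding Suc p_def diff_Suc_1 by linarith
    qed
  qed
  have Man: "Man M \<in> Lip1 X'" if "M \<in> Lip1 X" for M
    unfolding Man_def using short_edges.polygon_Lip1[OF p[OF that]] .
  have q: "short_edges X ?\<delta>'' (q M)" if M: "M \<in> Lip1 X" for M
  proof
    show "geodesic_space X" "?\<delta>'' > 0" by fact+
    have L: "\<sigma>' (Man M) \<in> Lip1 X'" using Man[OF M] \<sigma>'Lip by blast
    have Lg: "\<sigma>' (Man M) (real n * ?\<delta>') \<in> mspace X'" for n using Lip1D(1)[OF L] grid by blast
    then show "q M n \<in> mspace X" for n using \<psi> q_def by simp
    show "mdist X (q M n) (q M (Suc n)) \<le> ?\<delta>''" for n
    proof -
      have "mdist X' (\<sigma>' (Man M) (real n * ?\<delta>')) (\<sigma>' (Man M) (real (Suc n) * ?\<delta>')) \<le> ?\<delta>'"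
        using mdist_step_le[OF L] pos by simp
      moreover have "\<bar>mdist X' (\<sigma>' (Man M) (real n * ?\<delta>')) (\<sigma>' (Man M) (real (Suc n) * ?\<delta>')) -
          mdist X (q M n) (q M (Suc n))\<bar> \<le> \<eta>"
        unfolding q_def by (intro distortion \<psi> Lg)
      ultimately show ?thesis by linarith
    qed
  qed
  have \<sigma>Lip: "\<sigma> M \<in> Lip1 X" if "M \<in> Lip1 X" for M
    unfolding \<sigma>_def using short_edges.polygon_Lip1[OF q[OF that]] .
  have "nonanticipative_strategy X L0 \<sigma>"
    unfolding nonanticipative_strategy_def
  proof (intro conjI ballI allI impI)
    show "\<sigma> \<in> Lip1 X \<rightarrow> Lip1 X" using \<sigma>Lip by blast
    show "\<sigma> M 0 = L0" if M: "M \<in> Lip1 X" for M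
      using short_edges.polygon_vertex[OF q[OF M], of 0] \<sigma>'0[OF Man[OF M]] \<psi>0
      by (simp add: \<sigma>_def q_def)
    fix M1 M2 \<tau> t
    assume M: "M1 \<in> Lip1 X" "M2 \<in> Lip1 X" and "\<tau> \<ge> 0" and eq: "\<forall>t\<in>{0..\<tau>}. M1 t = M2 t"
      and t: "t \<in> {0..\<tau>}"
    obtain k where k: "real k * ?\<delta>'' \<le> t" "t < (real k + 1) * ?\<delta>''"
      using ex_grid_interval[OF pos(2), of t] t by auto
    \<comment> \<open>by the delay, vertices up to \<open>k + 1\<close> of the image of Man depend on Man only up to time
      \<open>k * \<delta>\<close>, which is not after \<open>t\<close>\<close>
    have "p M1 n = p M2 n" if "n \<le> Suc k" for n
    proof -
      have "real (n - 1) \<le> real k" using that by simp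
      then have "real (n - 1) * \<delta> \<le> real k * ?\<delta>''"
        using assms by (intro mult_mono) auto
      then have "real (n - 1) * \<delta> \<in> {0..\<tau>}"
        using k t grid(1)[of "n - 1"] by auto
      then show ?thesis using eq p_def by simp
    qed
    then have "Man M1 s = Man M2 s" if "0 \<le> s" "s \<le> real (Suc k) * ?\<delta>'" for s
      unfolding Man_def by (rule polygon_cong[OF p[OF M(1)] p[OF M(2)] _ that])
    then have Man_eq: "\<forall>s\<in>{0..real (Suc k) * ?\<delta>'}. Man M1 s = Man M2 s"
      by simp
    have "q M1 n = q M2 n" if "n \<le> Suc k" for n
    proof -
      have "real n * ?\<delta>' \<le> real (Suc k) * ?\<delta>'"
        using that pos by (intro mult_right_mono) auto
      then show ?thesis
        unfolding q_def using \<sigma>'na[OF Man[OF M(1)] Man[OF M(2)] Man_eq] grid(2)[of n] by metis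
    qed
    moreover have "0 \<le> t" "t \<le> real (Suc k) * ?\<delta>''"
      using k t by (auto simp: algebra_simps)
    ultimately show "\<sigma> M1 t = \<sigma> M2 t"
      unfolding \<sigma>_def by (rule polygon_cong[OF q[OF M(1)] q[OF M(2)]])
  qed
  moreover have "(INF t\<in>{0..T}. mdist X (M t) (\<sigma> M t)) \<le> \<alpha> + 3 * \<delta> + 3 * \<eta> + 3 * \<eta> * (T / \<delta>)"
    if M: "M \<in> Lip1 X" for M
  proof (rule field_le_epsilon)
    fix \<kappa> :: real assume "\<kappa> > 0"
    let ?M = "Man M" and ?L = "\<sigma>' (Man M)"
    have Lip': "?M \<in> Lip1 X'" "?L \<in> Lip1 X'" using Man[OF M] \<sigma>'Lip by blast+
    have "(INF t\<in>{0..T}. mdist X' (?M t) (?L t)) < \<alpha> + \<kappa>"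
      using \<sigma>'win[OF Lip'(1)] \<open>\<kappa> > 0\<close> by linarith
    moreover have "bdd_below ((\<lambda>t. mdist X' (?M t) (?L t)) ` {0..T})"
      by (rule bdd_belowI2[of _ 0]) simp
    ultimately obtain t where t: "0 \<le> t" "t \<le> T" "mdist X' (?M t) (?L t) < \<alpha> + \<kappa>"
      using \<open>T \<ge> 0\<close> by (auto simp: cINF_less_iff)
    obtain k where k: "real k * ?\<delta>' \<le> t" "t < (real k + 1) * ?\<delta>'"
      using ex_grid_interval[OF pos(1) t(1)] by blast
    define u where "u = real k * ?\<delta>'"
    define v where "v = real (k - 1) * \<delta>"
    have u: "0 \<le> u" "u \<le> t" "t - u \<le> ?\<delta>'" and v0: "0 \<le> v"
      using k grid by (auto simp: u_def v_def algebra_simps)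
    have "mdist X' (?M u) (?L u) \<le> mdist X' (?M u) (?M t) + mdist X' (?M t) (?L t) + mdist X' (?L t) (?L u)"
      using Lip' u t by (intro mdist_quad Lip1D)
    moreover have "mdist X' (?M u) (?M t) \<le> ?\<delta>'" "mdist X' (?L t) (?L u) \<le> ?\<delta>'"
      using Lip1D(2)[OF Lip'(1) u(1) t(1)] Lip1D(2)[OF Lip'(2) t(1) u(1)] u by auto
    ultimately have 1: "mdist X' (?M u) (?L u) \<le> \<alpha> + \<kappa> + 2 * \<delta> + 2 * \<eta>" using t(3) by linarith
    have "?M u = \<phi> (M v)"
      using short_edges.polygon_vertex[OF p[OF M]] by (simp add: Man_def p_def u_def v_def)
    moreover have "\<bar>mdist X' (\<phi> (M v)) (?L u) - mdist X (M v) (q M k)\<bar> \<le> \<eta>"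
      unfolding q_def u_def[symmetric] using M Lip' u v0 by (intro distortion \<phi> \<psi> Lip1D)
    ultimately have 2: "mdist X (M v) (q M k) \<le> \<alpha> + \<kappa> + 2 * \<delta> + 3 * \<eta>" using 1 by simp
    define w where "w = real k * ?\<delta>''"
    define s where "s = min w T"
    have "w \<ge> 0" using pos by (simp add: w_def)
    have s: "0 \<le> s" "s \<le> T" "s \<le> w" using \<open>w \<ge> 0\<close> \<open>T \<ge> 0\<close> by (auto simp: s_def)
    have kT: "real k * \<delta> + real k * \<eta> \<le> T" using k t by (simp add: algebra_simps)
    have k\<eta>: "0 \<le> real k * \<eta>" using \<open>\<eta> \<ge> 0\<close> by simp
    have weq: "w = real k * \<delta> + 2 * (real k * \<eta>)" by (simp add: w_def algebra_simps)
    have v: "v \<le> real k * \<delta>" "real k * \<delta> \<le> v + \<delta>"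
      using \<open>\<delta> > 0\<close> by (cases k; simp add: v_def algebra_simps)+
    have vs: "v \<le> s" "s - v \<le> \<delta> + 2 * (real k * \<eta>)" and sw: "w - s \<le> real k * \<eta>"
      using kT k\<eta> weq v unfolding s_def by linarith+
    have "\<sigma> M w = q M k"
      unfolding \<sigma>_def w_def using short_edges.polygon_vertex[OF q[OF M]] .
    then have "mdist X (q M k) (\<sigma> M s) \<le> real k * \<eta>"
      using Lip1D(2)[OF \<sigma>Lip[OF M] \<open>w \<ge> 0\<close> s(1)] s sw by simp
    moreover have "mdist X (M s) (M v) \<le> \<delta> + 2 * (real k * \<eta>)"
      using Lip1D(2)[OF M s(1) v0] vs by simp
    moreover have "mdist X (M s) (\<sigma> M s) \<le> mdist X (M s) (M v) + mdist X (M v) (q M k) + mdist X (q M k) (\<sigma> M s)"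
      using M \<sigma>Lip[OF M] v0 s short_edges.vertex[OF q[OF M]] by (intro mdist_quad) (auto intro: Lip1D)
    moreover have "real k * \<eta> \<le> \<eta> * (T / \<delta>)"
    proof -
      have "real k \<le> T / \<delta>" using kT k\<eta> \<open>\<delta> > 0\<close> by (simp add: field_simps)
      then have "\<eta> * real k \<le> \<eta> * (T / \<delta>)" using \<open>\<eta> \<ge> 0\<close> by (rule mult_left_mono)
      then show ?thesis by (simp only: mult.commute)
    qed
    ultimately have "mdist X (M s) (\<sigma> M s) \<le> \<alpha> + 3 * \<delta> + 3 * \<eta> + 3 * \<eta> * (T / \<delta>) + \<kappa>"
      using 2 by linarith
    moreover have "(INF t\<in>{0..T}. mdist X (M t) (\<sigma> M t)) \<le> mdist X (M s) (\<sigma> M s)"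
      using s by (intro cINF_lower bdd_belowI2[of _ 0]) auto
    ultimately show "(INF t\<in>{0..T}. mdist X (M t) (\<sigma> M t)) \<le> \<alpha> + 3 * \<delta> + 3 * \<eta> + 3 * \<eta> * (T / \<delta>) + \<kappa>"
      by linarith
  qed
  ultimately show "\<exists>\<sigma>. nonanticipative_strategy X L0 \<sigma> \<and>
      (\<forall>M\<in>Lip1 X. (INF t\<in>{0..T}. mdist X (M t) (\<sigma> M t)) \<le> \<alpha> + 3 * \<delta> + 3 * \<eta> + 3 * \<eta> * (T / \<delta>))"
    by blast
qed

theorem theorem1:
  fixes X' :: "'a metric" and X :: "'b metric" and T \<alpha> \<epsilon> :: real
  assumes "compact_space (mtopology_of X')" and "geodesic_space X'"
    and "compact_space (mtopology_of X)" and "geodesic_space X"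
    and "T > 0"
    and "\<alpha> \<in> {0<..<1}"
    and "\<epsilon> \<in> {0<..<\<alpha>\<^sup>2}"
    and "gh_dist X' X \<le> ennreal \<epsilon>"
    and "winning_strategies X' \<alpha> T"
  shows "winning_strategies X (\<alpha> + (20 * T + 8) * sqrt \<epsilon>) T"
proof -
  have "\<epsilon> > 0" using assms(7) by simp
  have "\<alpha>\<^sup>2 \<le> 1" using assms(6) by (auto simp: abs_square_le_1)
  then have "\<epsilon> \<le> 1" using assms(7) by simp
  define e where "e = sqrt \<epsilon>"
  have e: "0 < e" "e \<le> 1" "\<epsilon> = e * e"
    using \<open>\<epsilon> > 0\<close> \<open>\<epsilon> \<le> 1\<close> by (simp_all add: e_def)
  \<comment> \<open>the infimum in \<open>gh_dist\<close> need not be attained, so a radius larger than \<open>\<epsilon>\<close> is needed; the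
    factor \<open>21 / 20\<close> and the step \<open>e / 2\<close> below keep the error, as \<open>\<epsilon> \<le> e\<close>, within \<open>3/2 + 63/10 \<le> 8\<close> and
    \<open>63/5 * T \<le> 20 * T\<close> multiples of \<open>e\<close>\<close>
  have "ennreal \<epsilon> < ennreal (21 / 20 * \<epsilon>)"
    using \<open>\<epsilon> > 0\<close> by (intro ennreal_lessI) auto
  then have "gh_dist X' X < ennreal (21 / 20 * \<epsilon>)"
    using assms(8) by (rule le_less_trans[rotated])
  then obtain R where "correspondence X' X (2 * (21 / 20 * \<epsilon>)) R"
    using gh_dist_less_imp_correspondence by blast
  then have win: "winning_strategies X
      (\<alpha> + 3 * (e / 2) + 3 * (2 * (21 / 20 * \<epsilon>)) + 3 * (2 * (21 / 20 * \<epsilon>)) * (T / (e / 2))) T"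
    using assms \<open>\<epsilon> > 0\<close> e by (intro winning_strategies_transfer) auto
  have "\<epsilon> \<le> e" using e mult_left_mono[of e 1 e] by simp
  moreover have "3 * (2 * (21 / 20 * \<epsilon>)) * (T / (e / 2)) = 63 / 5 * (T * e)"
    using e by (simp add: field_simps)
  moreover have "0 \<le> T * e" using e assms by simp
  ultimately have "\<alpha> + 3 * (e / 2) + 3 * (2 * (21 / 20 * \<epsilon>)) + 3 * (2 * (21 / 20 * \<epsilon>)) * (T / (e / 2))
      \<le> \<alpha> + (20 * T + 8) * e"
    using e(1) by (simp add: algebra_simps)
  then show ?thesis
    using win unfolding winning_strategies_def e_def by (meson order_trans)
qed

end
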